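(* Let $\mathbb{G}_1$ be any graph and $\mathbb{G}_2$ be a non-compliant graph. Let $\mathbb{H}$ be the corona of $\mathbb{G}_1$ and $\mathbb{G}_2$. Then, $\mathbb{H}$ is compliant and $_{\mathbb{H}}d_{td}(b_{ij})\leq 2+(n-1)\gamma_t(\mathbb{G}_2),$ $i=1,2,...,n \text{ and } j=1,2,...,m.$
   Context: $\mathbb{G}_1$ has vertices $a_1,\dots,a_n$ and $\mathbb{G}_2$ has vertices $b_1,\dots,b_m$. The corona $\mathbb{H}=\mathbb{G}_1\odot\mathbb{G}_2$ is obtained by taking $n$ copies of $\mathbb{G}_2$, with vertices $b_{i1},\dots,b_{im}$ in the $i$-th copy, and joining $a_i$ to every vertex of the $i$-th copy. A total dominating set (TDS) is a vertex set $S$ such that every vertex is adjacent to a vertex of $S$; a minimal TDS (MTDS) has no proper subset that is a TDS; $\gamma_t$ is the minimum TDS cardinality. A vertex is compliant if some MTDS contains it; a graph is compliant if all its vertices are, non-compliant otherwise. For compliant $\mathbb{X}$, $_{\mathbb{X}}d_{td}(a)=\min\{|S| : S \text{ an MTDS of } \mathbb{X} \text{ containing } a\}$.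
   Formalization: It is additionally assumed that G_2 has a total dominating set, so that γ_t(G_2) is defined; otherwise the claim fails, e.g. for G_1 = K_2, G_2 = K_1, where the corona is P_4 and its leaves lie in no MTDS. *)

theory Defs
  imports "Graph_Theory.Graph_Theory"
begin

text \<open>A finite simple undirected graph is a \<^locale>\<open>pair_graph\<close>: finitely many vertices and an
  irreflexive symmetric arc set, so that two vertices \<open>u\<close>, \<open>v\<close> are adjacent iff
  \<open>(u, v) \<in> parcs G\<close>.\<close>

definition total_dominating_set :: "'a pair_pre_digraph \<Rightarrow> 'a set \<Rightarrow> bool" where
  "total_dominating_set G S \<longleftrightarrow>
     S \<subseteq> pverts G \<and> (\<forall>v\<in>pverts G. \<exists>u\<in>S. (v, u) \<in> parcs G)"

definition minimal_total_dominating_set :: "'a pair_pre_digraph \<Rightarrow> 'a set \<Rightarrow> bool" where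
  "minimal_total_dominating_set G S \<longleftrightarrow>
     total_dominating_set G S \<and> (\<forall>T. T \<subset> S \<longrightarrow> \<not> total_dominating_set G T)"

text \<open>Meaningful only if the graph has a total dominating set.\<close>

definition total_domination_number :: "'a pair_pre_digraph \<Rightarrow> nat" where
  "total_domination_number G = (LEAST k. \<exists>S. total_dominating_set G S \<and> card S = k)"

definition compliant_vertex :: "'a pair_pre_digraph \<Rightarrow> 'a \<Rightarrow> bool" where
  "compliant_vertex G a \<longleftrightarrow> (\<exists>S. minimal_total_dominating_set G S \<and> a \<in> S)"

definition compliant_graph :: "'a pair_pre_digraph \<Rightarrow> bool" where
  "compliant_graph G \<longleftrightarrow> (\<forall>a\<in>pverts G. compliant_vertex G a)"

text \<open>Meaningful only if the vertex is compliant.\<close>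

definition total_domination_degree :: "'a pair_pre_digraph \<Rightarrow> 'a \<Rightarrow> nat" where
  "total_domination_degree G a =
     (LEAST k. \<exists>S. minimal_total_dominating_set G S \<and> a \<in> S \<and> card S = k)"

text \<open>\<open>Inl a\<close> is the vertex \<open>a\<close> of the first graph; \<open>Inr (a, b)\<close> is the vertex \<open>b\<close> in the copy of
  the second graph attached to \<open>a\<close>.\<close>

definition corona ::
  "'a pair_pre_digraph \<Rightarrow> 'b pair_pre_digraph \<Rightarrow> ('a + 'a \<times> 'b) pair_pre_digraph" where
  "corona G\<^sub>1 G\<^sub>2 = \<lparr>
     pverts = Inl ` pverts G\<^sub>1 \<union> Inr ` (pverts G\<^sub>1 \<times> pverts G\<^sub>2),
     parcs = {(Inl a, Inl a') | a a'. (a, a') \<in> parcs G\<^sub>1}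
       \<union> {(Inr (a, b), Inr (a, b')) | a b b'. a \<in> pverts G\<^sub>1 \<and> (b, b') \<in> parcs G\<^sub>2}
       \<union> {(Inl a, Inr (a, b)) | a b. a \<in> pverts G\<^sub>1 \<and> b \<in> pverts G\<^sub>2}
       \<union> {(Inr (a, b), Inl a) | a b. a \<in> pverts G\<^sub>1 \<and> b \<in> pverts G\<^sub>2} \<rparr>"

lemma pair_graph_corona:
  assumes "pair_graph G\<^sub>1" and "pair_graph G\<^sub>2"
  shows "pair_graph (corona G\<^sub>1 G\<^sub>2)"
proof -
  interpret G\<^sub>1: pair_graph G\<^sub>1 by fact
  interpret G\<^sub>2: pair_graph G\<^sub>2 by fact
  have verts: "finite (pverts (corona G\<^sub>1 G\<^sub>2))"
    by (simp add: corona_def)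
  have wf: "parcs (corona G\<^sub>1 G\<^sub>2) \<subseteq> pverts (corona G\<^sub>1 G\<^sub>2) \<times> pverts (corona G\<^sub>1 G\<^sub>2)"
    by (auto simp: corona_def dest: G\<^sub>1.in_arcsD1 G\<^sub>1.in_arcsD2 G\<^sub>2.in_arcsD1 G\<^sub>2.in_arcsD2)
  have arcs: "finite (parcs (corona G\<^sub>1 G\<^sub>2))"
    using wf verts finite_subset by blast
  have s1: "(v, u) \<in> parcs G\<^sub>1" if "(u, v) \<in> parcs G\<^sub>1" for u v
    using that G\<^sub>1.arcs_symmetric by blast
  have s2: "(v, u) \<in> parcs G\<^sub>2" if "(u, v) \<in> parcs G\<^sub>2" for u v
    using that G\<^sub>2.arcs_symmetric by blast
  have sym: "symmetric (with_proj (corona G\<^sub>1 G\<^sub>2))"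
    by (auto simp: symmetric_def arcs_ends_def arc_to_ends_def sym_def corona_def
        intro: s1 s2)
  have loopfree: "fst e \<noteq> snd e" if "e \<in> parcs (corona G\<^sub>1 G\<^sub>2)" for e
    using that G\<^sub>1.pair_no_loops G\<^sub>2.pair_no_loops by (fastforce simp: corona_def)
  show ?thesis
    by unfold_locales (use wf verts arcs sym loopfree in auto)
qed

end

theory Submission
  imports Defs
begin

text \<open>In the copy attached to \<open>a\<close> the pair consisting of \<open>a\<close> and any vertex \<open>b\<close> of the copy is
  totally dominating, and neither vertex can be dropped: \<open>b\<close> is dominated only by \<open>a\<close>, and \<open>a\<close> only
  by \<open>b\<close>. In every other copy take a minimum total dominating set of \<open>G\<^sub>2\<close>; it dominates both the
  copy and the vertex the copy is attached to, and no vertex of \<open>G\<^sub>1\<close> other than \<open>a\<close> is used, so it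
  stays minimal.\<close>

text \<open>A total dominating set of least cardinality is minimal under inclusion, because a proper
  subset of a finite set has fewer elements.\<close>

lemma total_domination_numberE:
  assumes "finite (pverts G)" and "total_dominating_set G S"
  obtains M where "minimal_total_dominating_set G M" and "card M = total_domination_number G"
proof -
  have "\<exists>M. total_dominating_set G M \<and> card M = total_domination_number G"
    unfolding total_domination_number_def
    \<comment> \<open>The given \<open>S\<close> shows that the \<open>LEAST\<close> in the
      definition is attained.\<close>
    by (rule LeastI[where k = "card S"]) (use assms in blast)
  then obtain M where M: "total_dominating_set G M" "card M = total_domination_number G"
    by blast
  have "finite M"
    using M(1) assms(1) by (auto simp: total_dominating_set_def intro: finite_subset)
  have "\<not> total_dominating_set G T" if "T \<subset> M" for T
  proof
    assume "total_dominating_set G T"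
    then have "total_domination_number G \<le> card T"
      unfolding total_domination_number_def by (auto intro: Least_le)
    moreover have "card T < card M"
      using \<open>finite M\<close> that by (rule psubset_card_mono)
    ultimately show False using M(2) by simp
  qed
  with M that show thesis
    by (auto simp: minimal_total_dominating_set_def)
qed

lemma total_domination_degree_le:
  assumes "minimal_total_dominating_set G S" and "a \<in> S"
  shows "total_domination_degree G a \<le> card S"
  unfolding total_domination_degree_def by (rule Least_le) (use assms in blast)

definition corona_set :: "'a pair_pre_digraph \<Rightarrow> 'b set \<Rightarrow> 'a \<Rightarrow> 'b \<Rightarrow> ('a + 'a \<times> 'b) set" where
  "corona_set G\<^sub>1 M a b = {Inl a, Inr (a, b)} \<union> Inr ` ((pverts G\<^sub>1 - {a}) \<times> M)"

lemma card_corona_set: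
  assumes "finite (pverts G\<^sub>1)" and "a \<in> pverts G\<^sub>1" and "finite M"
  shows "card (corona_set G\<^sub>1 M a b) = 2 + (card (pverts G\<^sub>1) - 1) * card M"
proof -
  \<comment> \<open>The two parts are disjoint since the second avoids the copy at \<open>a\<close>.
    As \<open>a\<close> is a vertex, removing it lowers the count by exactly one, so the subtraction
    is not truncated.\<close>
  have "card (corona_set G\<^sub>1 M a b) =
      card {Inl a, Inr (a, b) :: 'a + 'a \<times> 'b} +
      card (Inr ` ((pverts G\<^sub>1 - {a}) \<times> M) :: ('a + 'a \<times> 'b) set)"
    unfolding corona_set_def by (rule card_Un_disjoint) (use assms in auto)
  then show ?thesis
    using assms by (simp add: card_image card_cartesian_product)
qed

text \<open>For minimality, a total dominating \<open>T\<close> inside the set is shown to be all of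
  it: \<open>Inl a\<close> and \<open>Inr (a, b)\<close> force each other into \<open>T\<close>, and
  every other copy reduces to the minimality of \<open>M\<close>.\<close>

lemma minimal_total_dominating_set_corona_set:
  assumes "pair_graph G\<^sub>1" and "pair_graph G\<^sub>2"
    and M: "minimal_total_dominating_set G\<^sub>2 M"
    and a: "a \<in> pverts G\<^sub>1" and b: "b \<in> pverts G\<^sub>2"
  shows "minimal_total_dominating_set (corona G\<^sub>1 G\<^sub>2) (corona_set G\<^sub>1 M a b)"
proof -
  let ?H = "corona G\<^sub>1 G\<^sub>2" and ?S = "corona_set G\<^sub>1 M a b"
  interpret G\<^sub>1: pair_graph G\<^sub>1 by fact
  interpret G\<^sub>2: pair_graph G\<^sub>2 by fact
  have M_sub: "M \<subseteq> pverts G\<^sub>2"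
    using M by (simp add: minimal_total_dominating_set_def total_dominating_set_def)
  have M_dom: "\<exists>d\<in>M. (c, d) \<in> parcs G\<^sub>2" if "c \<in> pverts G\<^sub>2" for c
    using M that by (auto simp: minimal_total_dominating_set_def total_dominating_set_def)
  have "total_dominating_set ?H ?S"
    unfolding total_dominating_set_def
  proof (intro conjI ballI)
    show "?S \<subseteq> pverts ?H"
      using a b M_sub by (auto simp: corona_set_def corona_def)
  next
    fix v assume "v \<in> pverts ?H"
    then consider x where "v = Inl x" "x \<in> pverts G\<^sub>1"
      | x c where "v = Inr (x, c)" "x \<in> pverts G\<^sub>1" "c \<in> pverts G\<^sub>2"
      by (auto simp: corona_def)
    then show "\<exists>u\<in>?S. (v, u) \<in> parcs ?H"
    proof cases
      case 1
      \<comment> \<open>\<open>M\<close> is nonempty because it dominates \<open>b\<close>. For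
        \<open>x \<noteq> a\<close> the vertex \<open>Inr (x, d)\<close> dominates
        \<open>Inl x\<close>; for \<open>x = a\<close> it is \<open>Inr (a, b)\<close>.\<close>
      obtain d where "d \<in> M" using M_dom[OF b] by blast
      with 1 a b M_sub show ?thesis
        by (cases "x = a") (auto simp: corona_set_def corona_def)
    next
      case 2
      obtain d where "d \<in> M" "(c, d) \<in> parcs G\<^sub>2" using M_dom[OF 2(3)] by blast
      with 2 a show ?thesis
        by (cases "x = a") (auto simp: corona_set_def corona_def)
    qed
  qed
  moreover have "\<not> total_dominating_set ?H T" if "T \<subset> ?S" for T
  proof
    assume T: "total_dominating_set ?H T"
    have dom: "\<exists>u\<in>T. (v, u) \<in> parcs ?H" if "v \<in> pverts ?H" for v
      using T that by (auto simp: total_dominating_set_def)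
    have TS: "u \<in> ?S" if "u \<in> T" for u
      using \<open>T \<subset> ?S\<close> that by blast
    \<comment> \<open>Inside \<open>?S\<close>, only \<open>Inl a\<close> and
      \<open>Inr (a, b)\<close> could dominate either of these two vertices; without loops, each
      must be dominated by the other.\<close>
    have no_loop: "(c, c) \<notin> parcs G\<^sub>1" "(d, d) \<notin> parcs G\<^sub>2" for c d
      using G\<^sub>1.pair_no_loops[of "(c, c)"] G\<^sub>2.pair_no_loops[of "(d, d)"] by auto
    obtain u where u: "u \<in> T" "(Inr (a, b), u) \<in> parcs ?H"
      using dom[of "Inr (a, b)"] a b by (auto simp: corona_def)
    then have "u = Inl a"
      using TS[OF u(1)] no_loop by (auto simp: corona_def corona_set_def)
    with u have "Inl a \<in> T" by simp
    obtain w where w: "w \<in> T" "(Inl a, w) \<in> parcs ?H"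
      using dom[of "Inl a"] a by (auto simp: corona_def)
    then have "w = Inr (a, b)"
      using TS[OF w(1)] no_loop by (auto simp: corona_def corona_set_def)
    with w have "Inr (a, b) \<in> T" by simp
    have "Inr (x, c) \<in> T" if x: "x \<in> pverts G\<^sub>1" "x \<noteq> a" and c: "c \<in> M" for x c
    proof -
      \<comment> \<open>The trace of \<open>T\<close> on the copy at \<open>x\<close>. It lies in
        \<open>M\<close>, so once it is total dominating it must equal \<open>M\<close>.\<close>
      let ?N = "{d. Inr (x, d) \<in> T}"
      have sub: "?N \<subseteq> M"
        using x by (auto simp: corona_set_def dest: TS)
      have "total_dominating_set G\<^sub>2 ?N"
        unfolding total_dominating_set_def
      proof (intro conjI ballI)
        show "?N \<subseteq> pverts G\<^sub>2" using sub M_sub by blast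
      next
        fix d assume "d \<in> pverts G\<^sub>2"
        then obtain u where u: "u \<in> T" "(Inr (x, d), u) \<in> parcs ?H"
          using dom[of "Inr (x, d)"] x by (auto simp: corona_def)
        \<comment> \<open>Since \<open>x \<noteq> a\<close>, the attachment vertex
          \<open>Inl x\<close> is outside \<open>?S\<close>, so the dominating vertex lies in the
          copy itself.\<close>
        have "u \<noteq> Inl x" using TS[OF u(1)] x by (auto simp: corona_set_def)
        with u show "\<exists>e\<in>?N. (d, e) \<in> parcs G\<^sub>2" by (auto simp: corona_def)
      qed
      with M sub have "?N = M"
        by (auto simp: minimal_total_dominating_set_def)
      with c show ?thesis by blast
    qed
    with \<open>Inl a \<in> T\<close> \<open>Inr (a, b) \<in> T\<close> have "?S \<subseteq> T" by (auto simp: corona_set_def)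
    with \<open>T \<subset> ?S\<close> show False by blast
  qed
  ultimately show ?thesis by (simp add: minimal_total_dominating_set_def)
qed

theorem theorem11:
  fixes G\<^sub>1 :: "'a pair_pre_digraph" and G\<^sub>2 :: "'b pair_pre_digraph"
  assumes "pair_graph G\<^sub>1" and "pair_graph G\<^sub>2"
    and "\<exists>S. total_dominating_set G\<^sub>2 S"
    and "\<not> compliant_graph G\<^sub>2"
  shows "compliant_graph (corona G\<^sub>1 G\<^sub>2) \<and>
    (\<forall>a\<in>pverts G\<^sub>1. \<forall>b\<in>pverts G\<^sub>2.
       total_domination_degree (corona G\<^sub>1 G\<^sub>2) (Inr (a, b))
         \<le> 2 + (card (pverts G\<^sub>1) - 1) * total_domination_number G\<^sub>2)"
proof -
  interpret G\<^sub>1: pair_graph G\<^sub>1 by fact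
  interpret G\<^sub>2: pair_graph G\<^sub>2 by fact
  obtain M where M: "minimal_total_dominating_set G\<^sub>2 M" "card M = total_domination_number G\<^sub>2"
    using assms(3) total_domination_numberE G\<^sub>2.pair_finite_verts by metis
  then have "M \<subseteq> pverts G\<^sub>2"
    by (simp add: minimal_total_dominating_set_def total_dominating_set_def)
  then have "finite M" using G\<^sub>2.pair_finite_verts by (rule finite_subset)
  note min = minimal_total_dominating_set_corona_set[OF assms(1,2) M(1)]
  \<comment> \<open>Non-compliance yields a vertex of \<open>G\<^sub>2\<close>, which serves as the
    partner of \<open>a\<close> in a minimal set containing \<open>Inl a\<close>.\<close>
  obtain b\<^sub>0 where b\<^sub>0: "b\<^sub>0 \<in> pverts G\<^sub>2"
    using assms(4) by (auto simp: compliant_graph_def)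
  have in_set: "Inl a \<in> corona_set G\<^sub>1 M a b" "Inr (a, b) \<in> corona_set G\<^sub>1 M a b" for a b
    by (simp_all add: corona_set_def)
  have "compliant_vertex (corona G\<^sub>1 G\<^sub>2) v" if "v \<in> pverts (corona G\<^sub>1 G\<^sub>2)" for v
  proof -
    from that consider a where "v = Inl a" "a \<in> pverts G\<^sub>1"
      | a b where "v = Inr (a, b)" "a \<in> pverts G\<^sub>1" "b \<in> pverts G\<^sub>2"
      by (auto simp: corona_def)
    then show ?thesis
      unfolding compliant_vertex_def by cases (use min b\<^sub>0 in_set in blast)+
  qed
  moreover have "total_domination_degree (corona G\<^sub>1 G\<^sub>2) (Inr (a, b))
      \<le> 2 + (card (pverts G\<^sub>1) - 1) * total_domination_number G\<^sub>2"
    if "a \<in> pverts G\<^sub>1" "b \<in> pverts G\<^sub>2" for a b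
    using total_domination_degree_le[OF min[OF that] in_set(2)]
      card_corona_set[OF G\<^sub>1.pair_finite_verts that(1) \<open>finite M\<close>] M(2)
    by simp
  ultimately show ?thesis by (simp add: compliant_graph_def)
qed

end
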